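(* Let $P$ be a dcpo satisfying the following condition: for every nonempty irreducible Scott closed set $F$ of $P$ with $F\neq P$, either $F$ is a down-linear element of the poset $Irr_{\sigma}(P)$, or $F$ is the supremum in $Irr_{\sigma}(P)$ of a directed set of down-linear elements of $Irr_{\sigma}(P)$. Then $P$ is $C_{\sigma}$-unique.
   Context: A dcpo (directed complete poset) is a poset in which every directed (in particular nonempty) subset has a supremum. For a poset $P$ and $A\subseteq P$, $\downarrow A=\{x\in P: x\le y\text{ for some }y\in A\}$ and $\downarrow a=\downarrow\{a\}$. A subset $A$ of a dcpo $P$ is Scott closed if $A=\downarrow A$ and $\bigvee D\in A$ for every directed $D\subseteq A$; these are the closed sets of the Scott topology. $C_{\sigma}(P)$ is the lattice of all Scott closed subsets of $P$ (including $\emptyset$), ordered by inclusion. A dcpo $P$ is $C_{\sigma}$-unique if for every dcpo $Q$, whenever the lattices $C_{\sigma}(P)$ and $C_{\sigma}(Q)$ are isomorphic, $P$ and $Q$ are order-isomorphic. A subset $A$ of a topological space is irreducible if whenever $A\subseteq F_1\cup F_2$ with $F_1,F_2$ closed, then $A\subseteq F_1$ or $A\subseteq F_2$. $Irr_{\sigma}(P)$ is the set of all nonempty irreducible Scott closed subsets of $P$ (irreducible with respect to the Scott topology), ordered by inclusion; it is a dcpo. An element $a$ of a poset is down-linear if $\downarrow a$ is a chain (any two elements of $\downarrow a$ are comparable). *)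

theory Defs
  imports "HOL-Algebra.Order" "HOL-Analysis.Abstract_Topology"
begin

text \<open>A poset is an \<^locale>\<open>partial_order\<close>: a carrier set, possibly empty, inside some type, with
  its order relation.\<close>

definition directed :: "('a, 'c) gorder_scheme \<Rightarrow> 'a set \<Rightarrow> bool" where
  "directed L D \<longleftrightarrow>
     D \<subseteq> carrier L \<and> D \<noteq> {} \<and> (\<forall>x\<in>D. \<forall>y\<in>D. \<exists>z\<in>D. x \<sqsubseteq>\<^bsub>L\<^esub> z \<and> y \<sqsubseteq>\<^bsub>L\<^esub> z)"

definition is_sup :: "('a, 'c) gorder_scheme \<Rightarrow> 'a \<Rightarrow> 'a set \<Rightarrow> bool" where
  "is_sup L s A \<longleftrightarrow> least L s (Upper L A)"

locale dcpo = partial_order L for L (structure) +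
  assumes directed_sup_exists: "directed L D \<Longrightarrow> \<exists>s. is_sup L s D"

definition down_set :: "('a, 'c) gorder_scheme \<Rightarrow> 'a set \<Rightarrow> 'a set" where
  "down_set L A = {x \<in> carrier L. \<exists>y\<in>A. x \<sqsubseteq>\<^bsub>L\<^esub> y}"

definition scott_closed :: "('a, 'c) gorder_scheme \<Rightarrow> 'a set \<Rightarrow> bool" where
  "scott_closed L A \<longleftrightarrow>
     A \<subseteq> carrier L \<and> A = down_set L A \<and>
     (\<forall>D s. directed L D \<and> D \<subseteq> A \<and> is_sup L s D \<longrightarrow> s \<in> A)"

definition scott_topology :: "('a, 'c) gorder_scheme \<Rightarrow> 'a topology" where
  "scott_topology L = topology (\<lambda>U. U \<subseteq> carrier L \<and> scott_closed L (carrier L - U))"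

definition irreducible_in :: "'a topology \<Rightarrow> 'a set \<Rightarrow> bool" where
  "irreducible_in X A \<longleftrightarrow>
     A \<subseteq> topspace X \<and>
     (\<forall>F\<^sub>1 F\<^sub>2. closedin X F\<^sub>1 \<and> closedin X F\<^sub>2 \<and> A \<subseteq> F\<^sub>1 \<union> F\<^sub>2 \<longrightarrow> A \<subseteq> F\<^sub>1 \<or> A \<subseteq> F\<^sub>2)"

definition inclusion_order :: "'a set set \<Rightarrow> 'a set gorder" where
  "inclusion_order S = \<lparr>carrier = S, eq = (=), le = (\<subseteq>)\<rparr>"

definition C_sigma :: "('a, 'c) gorder_scheme \<Rightarrow> 'a set gorder" where
  "C_sigma P = inclusion_order {A. scott_closed P A}"

definition Irr_sigma :: "('a, 'c) gorder_scheme \<Rightarrow> 'a set gorder" where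
  "Irr_sigma P = inclusion_order
     {A. A \<noteq> {} \<and> closedin (scott_topology P) A \<and> irreducible_in (scott_topology P) A}"

definition down_linear :: "('a, 'c) gorder_scheme \<Rightarrow> 'a \<Rightarrow> bool" where
  "down_linear L a \<longleftrightarrow>
     a \<in> carrier L \<and>
     (\<forall>x\<in>down_set L {a}. \<forall>y\<in>down_set L {a}. x \<sqsubseteq>\<^bsub>L\<^esub> y \<or> y \<sqsubseteq>\<^bsub>L\<^esub> x)"

definition order_isomorphic :: "('a, 'c) gorder_scheme \<Rightarrow> ('b, 'd) gorder_scheme \<Rightarrow> bool" where
  "order_isomorphic L M \<longleftrightarrow> (\<exists>f. order_emb L M f \<and> bij_betw f (carrier L) (carrier M))"

text \<open>HOL cannot quantify over types inside a formula, so the type in which the dcpos \<open>Q\<close> live is a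
  parameter; a theorem about \<open>C_sigma_unique TYPE('b) P\<close> with \<open>'b\<close> a type variable covers all \<open>Q\<close>.
  The isomorphism of the lattices \<open>C_sigma P\<close> and \<open>C_sigma Q\<close> is an order isomorphism, which is the
  same as a lattice isomorphism.\<close>

definition C_sigma_unique :: "'b itself \<Rightarrow> 'a gorder \<Rightarrow> bool" where
  "C_sigma_unique TYPE('b) P \<longleftrightarrow>
     dcpo P \<and>
     (\<forall>Q :: 'b gorder. dcpo Q \<longrightarrow>
        order_isomorphic (C_sigma P) (C_sigma Q) \<longrightarrow> order_isomorphic P Q)"

text \<open>The predicate given to \<^const>\<open>topology\<close> above does define a topology on a dcpo, with the Scott
  closed sets as its closed sets.\<close>

lemma scott_closed_iff:
  assumes "partial_order L"
  shows "scott_closed L A \<longleftrightarrow>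
    A \<subseteq> carrier L \<and> (\<forall>y\<in>A. \<forall>x\<in>carrier L. x \<sqsubseteq>\<^bsub>L\<^esub> y \<longrightarrow> x \<in> A) \<and>
    (\<forall>D s. directed L D \<and> D \<subseteq> A \<and> is_sup L s D \<longrightarrow> s \<in> A)"
proof -
  interpret partial_order L by fact
  have "A \<subseteq> down_set L A" if "A \<subseteq> carrier L"
    using that le_refl unfolding down_set_def by fast
  then have eq: "A = down_set L A \<longleftrightarrow> (\<forall>y\<in>A. \<forall>x\<in>carrier L. x \<sqsubseteq>\<^bsub>L\<^esub> y \<longrightarrow> x \<in> A)"
    if "A \<subseteq> carrier L"
    using that unfolding down_set_def by blast
  show ?thesis
    unfolding scott_closed_def by (rule conj_cong[OF HOL.refl], rule conj_cong[OF eq HOL.refl])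
qed

lemma scott_closed_Un:
  assumes "partial_order L" "scott_closed L A" "scott_closed L B"
  shows "scott_closed L (A \<union> B)"
proof -
  note closed = assms(2,3)[unfolded scott_closed_iff[OF assms(1)]]
  have sub: "A \<subseteq> carrier L" "B \<subseteq> carrier L"
    using closed by simp_all
  have down: "\<forall>y\<in>A. \<forall>x\<in>carrier L. x \<sqsubseteq>\<^bsub>L\<^esub> y \<longrightarrow> x \<in> A"
    "\<forall>y\<in>B. \<forall>x\<in>carrier L. x \<sqsubseteq>\<^bsub>L\<^esub> y \<longrightarrow> x \<in> B"
    using closed by simp_all
  have sups: "\<forall>D s. directed L D \<and> D \<subseteq> A \<and> is_sup L s D \<longrightarrow> s \<in> A"
    "\<forall>D s. directed L D \<and> D \<subseteq> B \<and> is_sup L s D \<longrightarrow> s \<in> B"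
    using closed by simp_all
  have sup: "s \<in> A \<union> B" if D: "directed L D" "D \<subseteq> A \<union> B" and s: "is_sup L s D" for D s
  proof (cases "D \<subseteq> A \<or> D \<subseteq> B")
    case True
    then show ?thesis using D s sups by blast
  next
    case False
    then obtain a b where ab: "a \<in> D" "a \<notin> A" "b \<in> D" "b \<notin> B" by blast
    then obtain z where z: "z \<in> D" "a \<sqsubseteq>\<^bsub>L\<^esub> z" "b \<sqsubseteq>\<^bsub>L\<^esub> z"
      using D unfolding directed_def by meson
    have "a \<in> carrier L" "b \<in> carrier L" using ab D unfolding directed_def by auto
    then have "z \<notin> A" "z \<notin> B" using ab z down by blast+
    then show ?thesis using z D by blast
  qed
  show ?thesis
    unfolding scott_closed_iff[OF assms(1)]
  proof (intro conjI)
    show "A \<union> B \<subseteq> carrier L" using sub by simp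
    show "\<forall>y\<in>A \<union> B. \<forall>x\<in>carrier L. x \<sqsubseteq>\<^bsub>L\<^esub> y \<longrightarrow> x \<in> A \<union> B" using down by blast
    show "\<forall>D s. directed L D \<and> D \<subseteq> A \<union> B \<and> is_sup L s D \<longrightarrow> s \<in> A \<union> B"
      by (intro allI impI, elim conjE, rule sup)
  qed
qed

lemma scott_closed_Inter:
  assumes "partial_order L" "\<And>A. A \<in> \<A> \<Longrightarrow> scott_closed L A"
  shows "scott_closed L (carrier L \<inter> \<Inter>\<A>)"
proof -
  have down: "x \<in> A" if "A \<in> \<A>" "y \<in> A" "x \<in> carrier L" "x \<sqsubseteq>\<^bsub>L\<^esub> y" for x y A
    using assms(2)[OF that(1)] that unfolding scott_closed_iff[OF assms(1)] by meson
  have sup: "s \<in> A" if "A \<in> \<A>" "directed L D" "D \<subseteq> A" "is_sup L s D" for s D A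
    using assms(2)[OF that(1)] that unfolding scott_closed_iff[OF assms(1)] by meson
  have "s \<in> carrier L" if "is_sup L s D" for s D
    using that unfolding is_sup_def least_def by blast
  note carrier = this
  show ?thesis
    unfolding scott_closed_iff[OF assms(1)]
  proof (intro conjI ballI allI impI)
    show "carrier L \<inter> \<Inter>\<A> \<subseteq> carrier L" by (rule Int_lower1)
  next
    fix x y
    assume "y \<in> carrier L \<inter> \<Inter>\<A>" "x \<in> carrier L" "x \<sqsubseteq>\<^bsub>L\<^esub> y"
    then show "x \<in> carrier L \<inter> \<Inter>\<A>" using down[of _ y x] by simp
  next
    fix D s
    assume D: "directed L D \<and> D \<subseteq> carrier L \<inter> \<Inter>\<A> \<and> is_sup L s D"
    have "s \<in> A" if "A \<in> \<A>" for A
      using D that by (intro sup[of A D s]) auto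
    then show "s \<in> carrier L \<inter> \<Inter>\<A>" using carrier[of s D] D by simp
  qed
qed

lemma scott_closed_empty: "scott_closed L {}"
  unfolding scott_closed_def down_set_def directed_def by auto

lemma istopology_scott:
  assumes "partial_order L"
  shows "istopology (\<lambda>U. U \<subseteq> carrier L \<and> scott_closed L (carrier L - U))"
  unfolding istopology_def
proof (intro conjI allI impI)
  fix S T
  assume "S \<subseteq> carrier L \<and> scott_closed L (carrier L - S)"
    "T \<subseteq> carrier L \<and> scott_closed L (carrier L - T)"
  then show "S \<inter> T \<subseteq> carrier L" "scott_closed L (carrier L - S \<inter> T)"
    unfolding Diff_Int by (blast, simp add: scott_closed_Un[OF assms])
next
  fix \<K>
  assume K: "\<forall>K\<in>\<K>. K \<subseteq> carrier L \<and> scott_closed L (carrier L - K)"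
  then show "\<Union>\<K> \<subseteq> carrier L" by blast
  have eq: "carrier L - \<Union>\<K> = carrier L \<inter> \<Inter>((\<lambda>K. carrier L - K) ` \<K>)" by blast
  show "scott_closed L (carrier L - \<Union>\<K>)"
    unfolding eq by (rule scott_closed_Inter[OF assms]) (use K in blast)
qed

lemma openin_scott_topology:
  assumes "partial_order L"
  shows "openin (scott_topology L) U \<longleftrightarrow> U \<subseteq> carrier L \<and> scott_closed L (carrier L - U)"
  unfolding scott_topology_def topology_inverse'[OF istopology_scott[OF assms]] by (rule HOL.refl)

lemma topspace_scott_topology:
  assumes "partial_order L"
  shows "topspace (scott_topology L) = carrier L"
proof (rule subset_antisym)
  show "topspace (scott_topology L) \<subseteq> carrier L"
    using openin_topspace[of "scott_topology L"] unfolding openin_scott_topology[OF assms] by simp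
  have "openin (scott_topology L) (carrier L)"
    unfolding openin_scott_topology[OF assms] by (simp add: scott_closed_empty)
  then show "carrier L \<subseteq> topspace (scott_topology L)" by (rule openin_subset)
qed

lemma closedin_scott_topology:
  assumes "partial_order L"
  shows "closedin (scott_topology L) A \<longleftrightarrow> scott_closed L A"
proof (cases "A \<subseteq> carrier L")
  case True
  then have "carrier L - (carrier L - A) = A" by blast
  then show ?thesis
    unfolding closedin_def topspace_scott_topology[OF assms] openin_scott_topology[OF assms]
    using True by simp
next
  case False
  moreover have "A \<subseteq> carrier L" if "scott_closed L A"
    using that unfolding scott_closed_def by (rule conjunct1)
  moreover have "A \<subseteq> carrier L" if "closedin (scott_topology L) A"
    using closedin_subset[OF that] unfolding topspace_scott_topology[OF assms] .
  ultimately show ?thesis by blast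
qed

end

theory Submission
  imports Defs
begin

text \<open>
  Nonempty irreducible Scott closed sets are the coprime elements of the lattice of Scott closed
  sets, so an isomorphism \<open>C_sigma P \<cong> C_sigma Q\<close> restricts to \<open>Irr_sigma P \<cong> Irr_sigma Q\<close>. Among
  them are the principal ideals \<open>\<down>x\<close>, and \<open>x \<mapsto> \<down>x\<close> is an order embedding. Hence \<open>P\<close> and \<open>Q\<close> are
  isomorphic as soon as the lattice isomorphism carries principal ideals to principal ideals in
  both directions.

  Down-linearity is visible in the order of \<open>Irr_sigma\<close>, and in every dcpo it forces principality:
  the points of a down-linear \<open>F\<close> form a chain, whose supremum lies in \<open>F\<close> and generates it.
  Directed suprema of principal ideals are again principal. So the hypothesis on \<open>P\<close> makes all
  irreducible closed sets other than the whole space principal, in \<open>P\<close> as well as in \<open>Q\<close>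
  (lemma \<open>proper_irreducible_principal\<close>).

  What remains is the whole space, which is principal exactly if there is a greatest element.
  Suppose \<open>P\<close> has a greatest element \<open>t\<close> and \<open>Q\<close> has none. Then \<open>t\<close> is not the supremum of a directed
  set of smaller elements: such elements correspond to a directed family of principal ideals of \<open>Q\<close>,
  whose supremum would be principal and equal to the whole of \<open>Q\<close>. So \<open>P - {t}\<close> is the
  largest proper Scott closed set of \<open>P\<close>. A point of \<open>Q\<close> outside its image then generates all of
  \<open>Q\<close>, a contradiction (lemma \<open>greatest_transfer\<close>).
\<close>

section \<open>Principal ideals and irreducible closed sets\<close>

abbreviation down_of :: "('a, 'c) gorder_scheme \<Rightarrow> 'a \<Rightarrow> 'a set" where
  "down_of L x \<equiv> down_set L {x}"

definition principal_ideal :: "('a, 'c) gorder_scheme \<Rightarrow> 'a set \<Rightarrow> bool" where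
  "principal_ideal L F \<longleftrightarrow> (\<exists>x\<in>carrier L. F = down_of L x)"

lemma mem_principal: "y \<in> down_of L x \<longleftrightarrow> y \<in> carrier L \<and> y \<sqsubseteq>\<^bsub>L\<^esub> x"
  by (simp add: down_set_def)

lemma is_sup_iff:
  "is_sup L s A \<longleftrightarrow> s \<in> carrier L \<and> (\<forall>x\<in>A \<inter> carrier L. x \<sqsubseteq>\<^bsub>L\<^esub> s) \<and>
     (\<forall>u\<in>carrier L. (\<forall>x\<in>A \<inter> carrier L. x \<sqsubseteq>\<^bsub>L\<^esub> u) \<longrightarrow> s \<sqsubseteq>\<^bsub>L\<^esub> u)"
  unfolding is_sup_def least_def Upper_def by auto

lemma carrier_Irr_sigma:
  assumes "partial_order L"
  shows "F \<in> carrier (Irr_sigma L) \<longleftrightarrow>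
    F \<noteq> {} \<and> scott_closed L F \<and>
    (\<forall>A B. scott_closed L A \<and> scott_closed L B \<and> F \<subseteq> A \<union> B \<longrightarrow> F \<subseteq> A \<or> F \<subseteq> B)"
proof -
  have "F \<subseteq> carrier L" if "scott_closed L F"
    using that unfolding scott_closed_def by simp
  then show ?thesis
    unfolding Irr_sigma_def inclusion_order_def irreducible_in_def
      closedin_scott_topology[OF assms] topspace_scott_topology[OF assms] by auto
qed

lemma le_Irr_sigma: "F \<sqsubseteq>\<^bsub>Irr_sigma L\<^esub> G \<longleftrightarrow> F \<subseteq> G"
  by (simp add: Irr_sigma_def inclusion_order_def)

context dcpo
begin

lemma principal_refl: "x \<in> carrier L \<Longrightarrow> x \<in> down_of L x"
  by (simp add: mem_principal)

lemma closed_subset: "scott_closed L A \<Longrightarrow> A \<subseteq> carrier L"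
  unfolding scott_closed_def by simp

lemma closed_downward:
  "scott_closed L A \<Longrightarrow> y \<in> A \<Longrightarrow> x \<in> carrier L \<Longrightarrow> x \<sqsubseteq> y \<Longrightarrow> x \<in> A"
  using scott_closed_iff[OF partial_order_axioms, of A] by blast

lemma closed_sup:
  "scott_closed L A \<Longrightarrow> directed L D \<Longrightarrow> D \<subseteq> A \<Longrightarrow> is_sup L s D \<Longrightarrow> s \<in> A"
  using scott_closed_iff[OF partial_order_axioms, of A] by blast

lemma closed_Un: "scott_closed L A \<Longrightarrow> scott_closed L B \<Longrightarrow> scott_closed L (A \<union> B)"
  by (rule scott_closed_Un[OF partial_order_axioms])

lemma closed_carrier: "scott_closed L (carrier L)"
  unfolding scott_closed_iff[OF partial_order_axioms] by (simp add: is_sup_iff)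

lemma closed_principal:
  assumes "x \<in> carrier L"
  shows "scott_closed L (down_of L x)"
  unfolding scott_closed_iff[OF partial_order_axioms]
proof (intro conjI ballI allI impI)
  show "down_of L x \<subseteq> carrier L" by (auto simp: mem_principal)
next
  fix y z assume "y \<in> down_of L x" "z \<in> carrier L" "z \<sqsubseteq> y"
  then show "z \<in> down_of L x" using assms le_trans by (auto simp: mem_principal)
next
  fix D s assume D: "directed L D \<and> D \<subseteq> down_of L x \<and> is_sup L s D"
  then have "\<forall>y\<in>D. y \<sqsubseteq> x" by (auto simp: mem_principal)
  then show "s \<in> down_of L x" using D assms by (auto simp: mem_principal is_sup_iff)
qed

lemma principal_subset_iff:
  assumes "scott_closed L A" "x \<in> carrier L"
  shows "down_of L x \<subseteq> A \<longleftrightarrow> x \<in> A"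
  using closed_downward[OF assms(1)] assms(2) principal_refl by (auto simp: mem_principal)

lemma principal_mono_iff:
  "x \<in> carrier L \<Longrightarrow> y \<in> carrier L \<Longrightarrow> down_of L x \<subseteq> down_of L y \<longleftrightarrow> x \<sqsubseteq> y"
  by (simp add: principal_subset_iff closed_principal mem_principal)

lemma principal_inj:
  assumes "x \<in> carrier L" "y \<in> carrier L" "down_of L x = down_of L y"
  shows "x = y"
  using assms principal_mono_iff[of x y] principal_mono_iff[of y x] le_antisym by blast

lemma principal_irreducible:
  assumes "x \<in> carrier L"
  shows "down_of L x \<in> carrier (Irr_sigma L)"
proof -
  have "down_of L x \<subseteq> A \<or> down_of L x \<subseteq> B"
    if "scott_closed L A" "scott_closed L B" "down_of L x \<subseteq> A \<union> B" for A B
    using that principal_refl[OF assms] principal_subset_iff[OF _ assms] by blast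
  then show ?thesis
    unfolding carrier_Irr_sigma[OF partial_order_axioms]
    using closed_principal[OF assms] principal_refl[OF assms] by blast
qed

text \<open>Among the irreducible subsets of a down-linear \<open>F\<close> are the ideals \<open>\<down>x\<close> for \<open>x \<in> F\<close>. So \<open>F\<close> is a
  chain, hence directed, and contains its supremum, which generates it.\<close>

lemma down_linear_principal_ideal:
  assumes "down_linear (Irr_sigma L) F"
  shows "principal_ideal L F"
proof -
  have F: "F \<noteq> {}" "scott_closed L F"
    using assms unfolding down_linear_def carrier_Irr_sigma[OF partial_order_axioms] by auto
  have chain: "x \<sqsubseteq> y \<or> y \<sqsubseteq> x" if "x \<in> F" "y \<in> F" for x y
  proof -
    have xy: "x \<in> carrier L" "y \<in> carrier L" using that closed_subset[OF F(2)] by auto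
    have "down_of L z \<in> down_set (Irr_sigma L) {F}" if "z \<in> F" "z \<in> carrier L" for z
      using that principal_irreducible principal_subset_iff[OF F(2)]
      by (simp add: mem_principal le_Irr_sigma)
    then have "down_of L x \<subseteq> down_of L y \<or> down_of L y \<subseteq> down_of L x"
      using assms that xy unfolding down_linear_def le_Irr_sigma by blast
    then show ?thesis using principal_mono_iff xy by blast
  qed
  have dir: "directed L F"
    unfolding directed_def
  proof (intro conjI ballI)
    fix x y assume "x \<in> F" "y \<in> F"
    then show "\<exists>z\<in>F. x \<sqsubseteq> z \<and> y \<sqsubseteq> z"
      using chain[of x y] le_refl closed_subset[OF F(2)] by (meson subsetD)
  qed (use F closed_subset in auto)
  then obtain s where s: "is_sup L s F" using directed_sup_exists by blast
  then have "s \<in> F" using closed_sup[OF F(2) dir] by blast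
  moreover have "s \<in> carrier L" "\<forall>x\<in>F. x \<sqsubseteq> s"
    using s closed_subset[OF F(2)] unfolding is_sup_iff by auto
  ultimately have "F = down_of L s"
    using closed_downward[OF F(2)] closed_subset[OF F(2)] by (auto simp: mem_principal)
  then show ?thesis unfolding principal_ideal_def using \<open>s \<in> carrier L\<close> by blast
qed

end

section \<open>Isomorphisms between lattices of Scott closed sets\<close>

text \<open>Naming both directions of the isomorphism makes the situation symmetric, so that each lemma
  can also be used for the inverse.\<close>

locale closed_set_iso = P: dcpo P + Q: dcpo Q
  for P :: "'a gorder" and Q :: "'b gorder" +
  fixes \<phi> :: "'a set \<Rightarrow> 'b set" and \<psi> :: "'b set \<Rightarrow> 'a set"
  assumes \<phi>_closed: "scott_closed P A \<Longrightarrow> scott_closed Q (\<phi> A)"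
    and \<psi>_closed: "scott_closed Q B \<Longrightarrow> scott_closed P (\<psi> B)"
    and \<psi>_\<phi>: "scott_closed P A \<Longrightarrow> \<psi> (\<phi> A) = A"
    and \<phi>_\<psi>: "scott_closed Q B \<Longrightarrow> \<phi> (\<psi> B) = B"
    and \<phi>_mono: "scott_closed P A \<Longrightarrow> scott_closed P A' \<Longrightarrow> A \<subseteq> A' \<Longrightarrow> \<phi> A \<subseteq> \<phi> A'"
    and \<psi>_mono: "scott_closed Q B \<Longrightarrow> scott_closed Q B' \<Longrightarrow> B \<subseteq> B' \<Longrightarrow> \<psi> B \<subseteq> \<psi> B'"
begin

lemma inverse: "closed_set_iso Q P \<psi> \<phi>"
  by unfold_locales (auto simp: \<phi>_closed \<psi>_closed \<psi>_\<phi> \<phi>_\<psi>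
      intro: \<phi>_mono[THEN subsetD] \<psi>_mono[THEN subsetD])

lemma subset_\<psi>_iff:
  assumes "scott_closed P A" "scott_closed Q B"
  shows "A \<subseteq> \<psi> B \<longleftrightarrow> \<phi> A \<subseteq> B"
  using \<phi>_mono[OF assms(1) \<psi>_closed[OF assms(2)]] \<psi>_mono[OF \<phi>_closed[OF assms(1)] assms(2)]
    \<psi>_\<phi>[OF assms(1)] \<phi>_\<psi>[OF assms(2)] by metis

lemma \<phi>_subset_iff:
  assumes "scott_closed P A" "scott_closed P A'"
  shows "\<phi> A \<subseteq> \<phi> A' \<longleftrightarrow> A \<subseteq> A'"
  using subset_\<psi>_iff[OF assms(1) \<phi>_closed[OF assms(2)]] \<psi>_\<phi>[OF assms(2)] by simp

lemma \<phi>_carrier: "\<phi> (carrier P) = carrier Q"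
proof (rule subset_antisym)
  show "\<phi> (carrier P) \<subseteq> carrier Q"
    using Q.closed_subset \<phi>_closed P.closed_carrier by blast
  have "\<psi> (carrier Q) \<subseteq> carrier P"
    using P.closed_subset \<psi>_closed Q.closed_carrier by blast
  then show "carrier Q \<subseteq> \<phi> (carrier P)"
    using \<phi>_mono[OF \<psi>_closed P.closed_carrier] \<phi>_\<psi> Q.closed_carrier by metis
qed

text \<open>Irreducible sets are the coprime elements of the lattice of closed sets: covering by \<open>A \<union> B\<close> is
  being below the join of \<open>A\<close> and \<open>B\<close>.\<close>

lemma irreducible_image:
  assumes "F \<in> carrier (Irr_sigma P)"
  shows "\<phi> F \<in> carrier (Irr_sigma Q)"
proof -
  have F: "F \<noteq> {}" "scott_closed P F"
    and irr: "\<And>A B. scott_closed P A \<Longrightarrow> scott_closed P B \<Longrightarrow> F \<subseteq> A \<union> B \<Longrightarrow> F \<subseteq> A \<or> F \<subseteq> B"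
    using assms unfolding carrier_Irr_sigma[OF P.partial_order_axioms] by auto
  have "\<phi> F \<noteq> {}"
  proof
    assume "\<phi> F = {}"
    then have "F \<subseteq> \<psi> (\<phi> {})"
      using subset_\<psi>_iff[OF F(2) \<phi>_closed[OF scott_closed_empty]] by simp
    then show False using F \<psi>_\<phi>[OF scott_closed_empty] by simp
  qed
  moreover have "\<phi> F \<subseteq> A \<or> \<phi> F \<subseteq> B"
    if A: "scott_closed Q A" and B: "scott_closed Q B" and sub: "\<phi> F \<subseteq> A \<union> B" for A B
  proof -
    have cl: "scott_closed P (\<psi> A)" "scott_closed P (\<psi> B)" "scott_closed P (\<psi> A \<union> \<psi> B)"
      using \<psi>_closed A B P.closed_Un by auto
    have "A \<subseteq> \<phi> (\<psi> A \<union> \<psi> B)" "B \<subseteq> \<phi> (\<psi> A \<union> \<psi> B)"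
      using \<phi>_mono[OF cl(1,3)] \<phi>_mono[OF cl(2,3)] \<phi>_\<psi>[OF A] \<phi>_\<psi>[OF B] by auto
    then have "\<phi> F \<subseteq> \<phi> (\<psi> A \<union> \<psi> B)" using sub by blast
    then have "F \<subseteq> \<psi> A \<union> \<psi> B" using \<phi>_subset_iff[OF F(2) cl(3)] by blast
    then have "F \<subseteq> \<psi> A \<or> F \<subseteq> \<psi> B" using irr cl by blast
    then show ?thesis using subset_\<psi>_iff[OF F(2)] A B by blast
  qed
  ultimately show ?thesis
    unfolding carrier_Irr_sigma[OF Q.partial_order_axioms] using \<phi>_closed[OF F(2)] by blast
qed

lemma down_linear_image:
  assumes "down_linear (Irr_sigma P) F"
  shows "down_linear (Irr_sigma Q) (\<phi> F)"
proof -
  interpret inv: closed_set_iso Q P \<psi> \<phi> by (rule inverse)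
  have closed: "scott_closed P F"
    using assms unfolding down_linear_def carrier_Irr_sigma[OF P.partial_order_axioms] by auto
  have "G \<subseteq> H \<or> H \<subseteq> G"
    if "G \<in> down_set (Irr_sigma Q) {\<phi> F}" "H \<in> down_set (Irr_sigma Q) {\<phi> F}" for G H
  proof -
    have cl: "scott_closed Q G" "scott_closed Q H"
      using that by (auto simp: mem_principal carrier_Irr_sigma[OF Q.partial_order_axioms])
    have "\<psi> G \<in> down_set (Irr_sigma P) {F}" "\<psi> H \<in> down_set (Irr_sigma P) {F}"
      using that inv.irreducible_image inv.subset_\<psi>_iff[OF _ closed] cl
      by (auto simp: mem_principal le_Irr_sigma)
    then have "\<psi> G \<subseteq> \<psi> H \<or> \<psi> H \<subseteq> \<psi> G"
      using assms unfolding down_linear_def le_Irr_sigma by blast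
    then show ?thesis using inv.\<phi>_subset_iff cl by blast
  qed
  moreover have "F \<in> carrier (Irr_sigma P)" using assms unfolding down_linear_def by simp
  ultimately show ?thesis
    unfolding down_linear_def le_Irr_sigma by (simp add: irreducible_image)
qed

text \<open>If the members of a directed family are sent to ideals \<open>\<down>y\<close>, then the points \<open>y\<close> form a directed
  set, and the ideal generated by its supremum is the least closed set containing all \<open>\<down>y\<close>.
  Being irreducible, that ideal competes in the supremum formed in \<open>Irr_sigma P\<close>.\<close>

lemma directed_sup_image_principal_ideal:
  assumes dir: "directed (Irr_sigma P) \<D>"
    and sup: "is_sup (Irr_sigma P) F \<D>"
    and principal: "\<And>G. G \<in> \<D> \<Longrightarrow> principal_ideal Q (\<phi> G)"
  shows "principal_ideal Q (\<phi> F)"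
proof -
  interpret inv: closed_set_iso Q P \<psi> \<phi> by (rule inverse)
  have \<D>: "\<D> \<subseteq> carrier (Irr_sigma P)" "\<D> \<noteq> {}"
    "\<And>G H. G \<in> \<D> \<Longrightarrow> H \<in> \<D> \<Longrightarrow> \<exists>K\<in>\<D>. G \<subseteq> K \<and> H \<subseteq> K"
    using dir unfolding directed_def le_Irr_sigma by auto
  have F: "F \<in> carrier (Irr_sigma P)" "\<And>G. G \<in> \<D> \<Longrightarrow> G \<subseteq> F"
    "\<And>H. H \<in> carrier (Irr_sigma P) \<Longrightarrow> (\<And>G. G \<in> \<D> \<Longrightarrow> G \<subseteq> H) \<Longrightarrow> F \<subseteq> H"
    using sup \<D>(1) unfolding is_sup_iff le_Irr_sigma by blast+
  have closed: "scott_closed P F" "\<And>G. G \<in> \<D> \<Longrightarrow> scott_closed P G"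
    using F(1) \<D>(1) by (auto simp: carrier_Irr_sigma[OF P.partial_order_axioms])
  define E where "E = {y \<in> carrier Q. \<exists>G\<in>\<D>. \<phi> G = down_of Q y}"
  have dirE: "directed Q E"
    unfolding directed_def
  proof (intro conjI ballI)
    show "E \<subseteq> carrier Q" by (auto simp: E_def)
    show "E \<noteq> {}" using \<D>(2) principal unfolding E_def principal_ideal_def by blast
    fix y z assume yE: "y \<in> E" and zE: "z \<in> E"
    obtain G where G: "G \<in> \<D>" "\<phi> G = down_of Q y" "y \<in> carrier Q"
      using yE by (auto simp: E_def)
    obtain H where H: "H \<in> \<D>" "\<phi> H = down_of Q z" "z \<in> carrier Q"
      using zE by (auto simp: E_def)
    obtain K where K: "K \<in> \<D>" "G \<subseteq> K" "H \<subseteq> K" using \<D>(3) G(1) H(1) by blast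
    obtain w where w: "w \<in> carrier Q" "\<phi> K = down_of Q w"
      using principal[OF K(1)] unfolding principal_ideal_def by blast
    have "down_of Q y \<subseteq> down_of Q w" "down_of Q z \<subseteq> down_of Q w"
      using \<phi>_mono[OF closed(2)[OF G(1)] closed(2)[OF K(1)] K(2)]
        \<phi>_mono[OF closed(2)[OF H(1)] closed(2)[OF K(1)] K(3)] G(2) H(2) w(2) by simp_all
    then show "\<exists>w\<in>E. y \<sqsubseteq>\<^bsub>Q\<^esub> w \<and> z \<sqsubseteq>\<^bsub>Q\<^esub> w"
      using Q.principal_mono_iff G(3) H(3) w K(1) unfolding E_def by blast
  qed
  then obtain u where u: "is_sup Q u E" using Q.directed_sup_exists by blast
  then have uQ: "u \<in> carrier Q" by (simp add: is_sup_iff)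
  note cl_u = Q.closed_principal[OF uQ]
  have "G \<subseteq> \<psi> (down_of Q u)" if G: "G \<in> \<D>" for G
  proof -
    obtain y where y: "y \<in> carrier Q" "\<phi> G = down_of Q y"
      using principal[OF G] unfolding principal_ideal_def by blast
    then have "y \<sqsubseteq>\<^bsub>Q\<^esub> u" using u G unfolding E_def is_sup_iff by blast
    then show ?thesis
      using y uQ Q.principal_mono_iff subset_\<psi>_iff[OF closed(2)[OF G] cl_u] by simp
  qed
  then have "F \<subseteq> \<psi> (down_of Q u)"
    using F(3) inv.irreducible_image[OF Q.principal_irreducible[OF uQ]] by blast
  then have "\<phi> F \<subseteq> down_of Q u" using subset_\<psi>_iff[OF closed(1) cl_u] by blast
  moreover have "E \<subseteq> \<phi> F"
  proof
    fix y assume "y \<in> E"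
    then obtain G where "G \<in> \<D>" "\<phi> G = down_of Q y" "y \<in> carrier Q" unfolding E_def by blast
    then show "y \<in> \<phi> F"
      using \<phi>_mono[OF closed(2) closed(1) F(2)] Q.principal_refl by blast
  qed
  then have "u \<in> \<phi> F" by (rule Q.closed_sup[OF \<phi>_closed[OF closed(1)] dirE _ u])
  then have "down_of Q u \<subseteq> \<phi> F"
    using Q.principal_subset_iff[OF \<phi>_closed[OF closed(1)] uQ] by blast
  ultimately show ?thesis unfolding principal_ideal_def using uQ by blast
qed

end

definition generated_by_down_linear :: "('a, 'c) gorder_scheme \<Rightarrow> 'a set \<Rightarrow> bool" where
  "generated_by_down_linear L F \<longleftrightarrow>
     down_linear (Irr_sigma L) F \<or>
     (\<exists>\<D>. directed (Irr_sigma L) \<D> \<and> (\<forall>G\<in>\<D>. down_linear (Irr_sigma L) G) \<and>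
          is_sup (Irr_sigma L) F \<D>)"

context closed_set_iso
begin

text \<open>The description of \<open>\<psi> G\<close> by down-linear elements carries over to \<open>G\<close>, since it only uses the order
  of \<open>Irr_sigma P\<close>. The conclusion speaks of the second dcpo only; for the first one, apply the lemma
  to an isomorphism from \<open>P\<close> to itself.\<close>

lemma proper_irreducible_principal:
  assumes gen: "\<And>F. F \<in> carrier (Irr_sigma P) \<Longrightarrow> F \<noteq> carrier P \<Longrightarrow> generated_by_down_linear P F"
    and G: "G \<in> carrier (Irr_sigma Q)" "G \<noteq> carrier Q"
  shows "principal_ideal Q G"
proof -
  interpret inv: closed_set_iso Q P \<psi> \<phi> by (rule inverse)
  have closed: "scott_closed Q G"
    using G(1) by (simp add: carrier_Irr_sigma[OF Q.partial_order_axioms])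
  have "\<psi> G \<in> carrier (Irr_sigma P)" by (rule inv.irreducible_image[OF G(1)])
  moreover have "\<psi> G \<noteq> carrier P" using \<phi>_carrier \<phi>_\<psi>[OF closed] G(2) by metis
  ultimately have "generated_by_down_linear P (\<psi> G)" by (rule gen)
  then have "principal_ideal Q (\<phi> (\<psi> G))"
    unfolding generated_by_down_linear_def
  proof (elim disjE exE conjE)
    assume "down_linear (Irr_sigma P) (\<psi> G)"
    then show ?thesis by (rule Q.down_linear_principal_ideal[OF down_linear_image])
  next
    fix \<D>
    assume \<D>: "directed (Irr_sigma P) \<D>" "\<forall>G\<in>\<D>. down_linear (Irr_sigma P) G"
      "is_sup (Irr_sigma P) (\<psi> G) \<D>"
    have "principal_ideal Q (\<phi> H)" if "H \<in> \<D>" for H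
      using \<D>(2) that by (intro Q.down_linear_principal_ideal down_linear_image) (rule bspec)
    then show ?thesis by (rule directed_sup_image_principal_ideal[OF \<D>(1,3)])
  qed
  then show ?thesis by (simp add: \<phi>_\<psi>[OF closed])
qed

section \<open>Greatest elements\<close>

text \<open>\<open>principal_ideal P (carrier P)\<close> says that \<open>P\<close> has a greatest element. What has to be
  excluded is that \<open>P\<close> is \<open>Q\<close> with a greatest element added: then \<open>\<phi>\<close> could match every principal ideal
  of \<open>P\<close> except \<open>P\<close> itself with one of \<open>Q\<close>. The largest proper closed set tells them apart: \<open>P\<close> has
  one, which would force a greatest element in \<open>Q\<close>.\<close>

lemma greatest_transfer:
  assumes proper: "\<And>G. G \<in> carrier (Irr_sigma Q) \<Longrightarrow> G \<noteq> carrier Q \<Longrightarrow> principal_ideal Q G"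
    and top: "principal_ideal P (carrier P)"
  shows "principal_ideal Q (carrier Q)"
proof (rule ccontr)
  assume no_top: "\<not> principal_ideal Q (carrier Q)"
  from top obtain t where t: "t \<in> carrier P" and "carrier P = down_of P t"
    unfolding principal_ideal_def ..
  then have down_t: "down_of P t = carrier P" by simp
  have le_t: "x \<sqsubseteq>\<^bsub>P\<^esub> t" if "x \<in> carrier P" for x
    using that down_t mem_principal[of x P t] by simp
  have whole: "A = carrier P" if "scott_closed P A" "t \<in> A" for A
    using P.principal_subset_iff[OF that(1) t] that(2) down_t P.closed_subset[OF that(1)] by auto
  let ?M = "carrier P - {t}"
  have M: "scott_closed P ?M"
    unfolding scott_closed_iff[OF P.partial_order_axioms]
  proof (intro conjI ballI allI impI)
    show "?M \<subseteq> carrier P" by blast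
  next
    fix x y assume "y \<in> ?M" "x \<in> carrier P" "x \<sqsubseteq>\<^bsub>P\<^esub> y"
    then show "x \<in> ?M" using le_t[of y] P.le_antisym t by auto
  next
    fix D s assume D: "directed P D \<and> D \<subseteq> ?M \<and> is_sup P s D"
    then have DP: "D \<subseteq> carrier P" "D \<noteq> {}"
      and Ddir: "\<And>x y. x \<in> D \<Longrightarrow> y \<in> D \<Longrightarrow> \<exists>z\<in>D. x \<sqsubseteq>\<^bsub>P\<^esub> z \<and> y \<sqsubseteq>\<^bsub>P\<^esub> z"
      unfolding directed_def by auto
    have s: "s \<in> carrier P" "\<And>x. x \<in> D \<Longrightarrow> x \<sqsubseteq>\<^bsub>P\<^esub> s"
      using D DP unfolding is_sup_iff by auto
    \<comment> \<open>Otherwise \<open>\<down>t\<close> is the supremum in \<open>Irr_sigma P\<close> of the ideals \<open>\<down>d\<close> for \<open>d \<in> D\<close>. Each of them is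
      proper, so has a principal image, and then \<open>\<phi>\<close> sends \<open>\<down>t\<close>, the whole of \<open>P\<close>, to a principal
      ideal as well.\<close>
    have "s \<noteq> t"
    proof
      assume st: "s = t"
      have "directed (Irr_sigma P) (down_of P ` D)"
        unfolding directed_def le_Irr_sigma
      proof (intro conjI ballI)
        show "down_of P ` D \<subseteq> carrier (Irr_sigma P)"
          using P.principal_irreducible DP by blast
        show "down_of P ` D \<noteq> {}" using DP by blast
        fix G H assume "G \<in> down_of P ` D" "H \<in> down_of P ` D"
        then obtain x y where xy: "x \<in> D" "y \<in> D" "G = down_of P x" "H = down_of P y"
          by blast
        obtain z where "z \<in> D" "x \<sqsubseteq>\<^bsub>P\<^esub> z" "y \<sqsubseteq>\<^bsub>P\<^esub> z" using Ddir xy by blast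
        moreover have "x \<in> carrier P" "y \<in> carrier P" "z \<in> carrier P"
          using xy \<open>z \<in> D\<close> DP by auto
        ultimately show "\<exists>K\<in>down_of P ` D. G \<subseteq> K \<and> H \<subseteq> K"
          using P.principal_mono_iff xy by blast
      qed
      moreover have "is_sup (Irr_sigma P) (carrier P) (down_of P ` D)"
        unfolding is_sup_iff le_Irr_sigma
      proof (intro conjI ballI impI)
        show "carrier P \<in> carrier (Irr_sigma P)" using P.principal_irreducible[OF t] down_t by simp
        fix G assume "G \<in> down_of P ` D \<inter> carrier (Irr_sigma P)"
        then show "G \<subseteq> carrier P" by (auto simp: mem_principal)
      next
        fix H assume H: "H \<in> carrier (Irr_sigma P)"
          "\<forall>G\<in>down_of P ` D \<inter> carrier (Irr_sigma P). G \<subseteq> H"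
        have cl: "scott_closed P H"
          using H(1) by (simp add: carrier_Irr_sigma[OF P.partial_order_axioms])
        have "D \<subseteq> H"
        proof
          fix d assume d: "d \<in> D"
          then have dP: "d \<in> carrier P" using DP by auto
          then have "down_of P d \<subseteq> H" using H(2) d P.principal_irreducible by simp
          then show "d \<in> H" using P.principal_refl[OF dP] by auto
        qed
        then have "t \<in> H" using P.closed_sup[OF cl] D st by blast
        then show "carrier P \<subseteq> H" using whole[OF cl] by simp
      qed
      moreover have "principal_ideal Q (\<phi> G)" if "G \<in> down_of P ` D" for G
      proof -
        from that obtain d where d: "d \<in> D" "G = down_of P d" by blast
        then have dP: "d \<in> carrier P" "d \<noteq> t" using D by auto
        have "\<not> carrier P \<subseteq> G"
          using dP P.principal_mono_iff[OF t dP(1)] t down_t d le_t[OF dP(1)] P.le_antisym[of d t]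
          by auto
        then have "\<phi> G \<noteq> carrier Q"
          using \<phi>_subset_iff[OF P.closed_carrier P.closed_principal[OF dP(1)]] \<phi>_carrier d by simp
        then show ?thesis
          using proper irreducible_image[OF P.principal_irreducible[OF dP(1)]] d by simp
      qed
      ultimately have "principal_ideal Q (\<phi> (carrier P))"
        by (rule directed_sup_image_principal_ideal)
      then show False using no_top \<phi>_carrier by simp
    qed
    then show "s \<in> ?M" using s by blast
  qed
  \<comment> \<open>As \<open>?M\<close> is the largest proper closed set, a point outside its image generates everything.\<close>
  have "\<not> carrier P \<subseteq> ?M" using t by blast
  then have "\<not> carrier Q \<subseteq> \<phi> ?M" using \<phi>_subset_iff[OF P.closed_carrier M] \<phi>_carrier by simp
  then obtain y where y: "y \<in> carrier Q" "y \<notin> \<phi> ?M" by blast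
  note cl = Q.closed_principal[OF y(1)]
  have "\<not> down_of Q y \<subseteq> \<phi> ?M" using Q.principal_refl y by blast
  then have "\<not> \<psi> (down_of Q y) \<subseteq> ?M"
    using \<phi>_mono[OF \<psi>_closed[OF cl] M] \<phi>_\<psi>[OF cl] by metis
  then have "t \<in> \<psi> (down_of Q y)" using P.closed_subset[OF \<psi>_closed[OF cl]] by blast
  then have "\<psi> (down_of Q y) = carrier P" by (rule whole[OF \<psi>_closed[OF cl]])
  then have "down_of Q y = carrier Q" using \<phi>_\<psi>[OF cl] \<phi>_carrier by simp
  then show False using no_top y(1) unfolding principal_ideal_def by blast
qed

text \<open>The image of \<open>\<down>x\<close> is the whole of \<open>Q\<close> only if \<open>x\<close> is the greatest element of \<open>P\<close>.\<close>

lemma principal_image: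
  assumes proper: "\<And>G. G \<in> carrier (Irr_sigma Q) \<Longrightarrow> G \<noteq> carrier Q \<Longrightarrow> principal_ideal Q G"
    and x: "x \<in> carrier P"
  shows "principal_ideal Q (\<phi> (down_of P x))"
proof (cases "\<phi> (down_of P x) = carrier Q")
  case True
  then have "down_of P x = carrier P"
    using \<psi>_\<phi>[OF P.closed_principal[OF x]] \<psi>_\<phi>[OF P.closed_carrier] \<phi>_carrier by metis
  then have "principal_ideal P (carrier P)" using x unfolding principal_ideal_def by metis
  then show ?thesis using greatest_transfer[OF proper] True by simp
next
  case False
  then show ?thesis using proper irreducible_image[OF P.principal_irreducible[OF x]] by blast
qed

section \<open>From closed sets to points\<close>

lemma order_isomorphic_if_principal:
  assumes PQ: "\<And>x. x \<in> carrier P \<Longrightarrow> principal_ideal Q (\<phi> (down_of P x))"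
    and QP: "\<And>y. y \<in> carrier Q \<Longrightarrow> principal_ideal P (\<psi> (down_of Q y))"
  shows "order_isomorphic P Q"
proof -
  obtain f where f: "\<And>x. x \<in> carrier P \<Longrightarrow> f x \<in> carrier Q \<and> \<phi> (down_of P x) = down_of Q (f x)"
    using PQ unfolding principal_ideal_def by metis
  have le: "f x \<sqsubseteq>\<^bsub>Q\<^esub> f y \<longleftrightarrow> x \<sqsubseteq>\<^bsub>P\<^esub> y" if "x \<in> carrier P" "y \<in> carrier P" for x y
    using that f[OF that(1)] f[OF that(2)] Q.principal_mono_iff[of "f x" "f y"]
      P.principal_mono_iff[of x y] \<phi>_subset_iff[OF P.closed_principal P.closed_principal, of x y]
    by simp
  have "inj_on f (carrier P)"
    using le f P.le_antisym Q.le_refl by (intro inj_onI) metis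
  moreover have "f ` carrier P = carrier Q"
  proof
    show "f ` carrier P \<subseteq> carrier Q" using f by blast
    show "carrier Q \<subseteq> f ` carrier P"
    proof
      fix y assume y: "y \<in> carrier Q"
      obtain x where x: "x \<in> carrier P" "\<psi> (down_of Q y) = down_of P x"
        using QP[OF y] unfolding principal_ideal_def by blast
      have "down_of Q y = down_of Q (f x)"
        using \<phi>_\<psi>[OF Q.closed_principal[OF y]] x f by metis
      then have "y = f x" using Q.principal_inj y f x by blast
      then show "y \<in> f ` carrier P" using x by blast
    qed
  qed
  ultimately show ?thesis
    unfolding order_isomorphic_def order_emb_def bij_betw_def
    using le P.weak_partial_order_axioms Q.weak_partial_order_axioms by blast
qed

end

lemma closed_set_iso_exists:
  fixes P :: "'a gorder" and Q :: "'b gorder"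
  assumes "dcpo P" "dcpo Q" "order_isomorphic (C_sigma P) (C_sigma Q)"
  obtains \<phi> \<psi> where "closed_set_iso P Q \<phi> \<psi>"
proof -
  interpret P: dcpo P by fact
  interpret Q: dcpo Q by fact
  obtain \<phi> where emb: "order_emb (C_sigma P) (C_sigma Q) \<phi>"
    and bij: "bij_betw \<phi> {A. scott_closed P A} {B. scott_closed Q B}"
    using assms(3) unfolding order_isomorphic_def by (auto simp: C_sigma_def inclusion_order_def)
  have le: "\<phi> A \<subseteq> \<phi> B \<longleftrightarrow> A \<subseteq> B" if "scott_closed P A" "scott_closed P B" for A B
    using emb that unfolding order_emb_def by (simp add: C_sigma_def inclusion_order_def)
  let ?\<psi> = "inv_into {A. scott_closed P A} \<phi>"
  have inv: "scott_closed P (?\<psi> B)" "\<phi> (?\<psi> B) = B" if "scott_closed Q B" for B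
    using bij_betwE[OF bij_betw_inv_into[OF bij]] bij_betw_inv_into_right[OF bij] that by auto
  have "closed_set_iso P Q \<phi> ?\<psi>"
  proof unfold_locales
    show "scott_closed Q (\<phi> A)" if "scott_closed P A" for A using bij_betwE[OF bij] that by blast
    show "?\<psi> (\<phi> A) = A" if "scott_closed P A" for A
      using bij_betw_inv_into_left[OF bij] that by blast
    show "?\<psi> B \<subseteq> ?\<psi> B'" if "scott_closed Q B" "scott_closed Q B'" "B \<subseteq> B'" for B B'
      using that inv le by metis
  qed (use inv le in auto)
  then show ?thesis by (rule that)
qed

theorem theorem3p5:
  fixes P :: "'a gorder"
  assumes "dcpo P"
    and "\<And>F. F \<in> carrier (Irr_sigma P) \<Longrightarrow> F \<noteq> carrier P \<Longrightarrow>
           down_linear (Irr_sigma P) F \<or>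
           (\<exists>\<D>. directed (Irr_sigma P) \<D> \<and> (\<forall>G\<in>\<D>. down_linear (Irr_sigma P) G) \<and>
                is_sup (Irr_sigma P) F \<D>)"
  shows "C_sigma_unique TYPE('b) P"
  unfolding C_sigma_unique_def
proof (intro conjI allI impI)
  show "dcpo P" by fact
  fix Q :: "'b gorder"
  assume "dcpo Q" "order_isomorphic (C_sigma P) (C_sigma Q)"
  then obtain \<phi> \<psi> where "closed_set_iso P Q \<phi> \<psi>" using closed_set_iso_exists assms(1) by blast
  then interpret closed_set_iso P Q \<phi> \<psi> .
  interpret inv: closed_set_iso Q P \<psi> \<phi> by (rule inverse)
  \<comment> \<open>The identity isomorphism gives the principality of proper irreducible sets in \<open>P\<close> itself.\<close>
  interpret ident: closed_set_iso P P "\<lambda>A. A" "\<lambda>A. A" by unfold_locales auto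
  have gen: "generated_by_down_linear P F" if "F \<in> carrier (Irr_sigma P)" "F \<noteq> carrier P" for F
    unfolding generated_by_down_linear_def using that by (rule assms(2))
  show "order_isomorphic P Q"
  proof (rule order_isomorphic_if_principal)
    show "principal_ideal Q (\<phi> (down_of P x))" if "x \<in> carrier P" for x
      using principal_image[OF proper_irreducible_principal[OF gen] that] .
    show "principal_ideal P (\<psi> (down_of Q y))" if "y \<in> carrier Q" for y
      using inv.principal_image[OF ident.proper_irreducible_principal[OF gen] that] .
  qed
qed

end
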